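(* Let $(I\times\Omega,\mathcal I\boxtimes\mathcal F,\lambda\boxtimes P)$ be a Fubini extension and let $f$ be a process from $(I\times\Omega,\mathcal I\boxtimes\mathcal F,\lambda\boxtimes P)$ to a Polish space $X$. Then $f$ is essentially pairwise exchangeable if and only if $f$ is essentially i.i.d. conditioned on the $\sigma$-algebra generated by the mapping $\omega\mapsto\lambda f_\omega^{-1}$ from $\Omega$ to $\mathcal M(X)$.
   Context: All probability spaces are countably additive and complete. $(I,\mathcal I,\lambda)$ is an atomless probability space and $(\Omega,\mathcal F,P)$ is a probability space. A probability space $(I\times\Omega,\mathcal W,Q)$ extending the usual product space $(I\times\Omega,\mathcal I\otimes\mathcal F,\lambda\otimes P)$ is a Fubini extension if for every real-valued $Q$-integrable function $h$ on $(I\times\Omega,\mathcal W)$: (1) $h_i=h(i,\cdot)$ is integrable on $(\Omega,\mathcal F,P)$ for $\lambda$-almost all $i$, and $h_\omega=h(\cdot,\omega)$ is integrable on $(I,\mathcal I,\lambda)$ for $P$-almost all $\omega$; (2) $i\mapsto\int_\Omega h_i\,dP$ and $\omega\mapsto\int_I h_\omega\,d\lambda$ are integrable on $(I,\mathcal I,\lambda)$ and $(\Omega,\mathcal F,P)$ respectively, and $\int h\,dQ=\int_I\int_\Omega h_i\,dP\,d\lambda=\int_\Omega\int_I h_\omega\,d\lambda\,dP$. It is then denoted $(I\times\Omega,\mathcal I\boxtimes\mathcal F,\lambda\boxtimes P)$. $X$ has Borel $\sigma$-algebra $\mathcal B$; $\mathcal M(X)$ is the space of Borel probability measures on $X$.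 A process from the Fubini extension to $X$ is an $\mathcal I\boxtimes\mathcal F$-measurable map $f:I\times\Omega\to X$; $f_i=f(i,\cdot)$, $f_\omega=f(\cdot,\omega)$. $\lambda f_\omega^{-1}$ is the distribution of $f_\omega$ under $\lambda$ (defined for $P$-almost all $\omega$; values on a $P$-null set are irrelevant). Convention: sub-$\sigma$-algebras of $\mathcal F$ conditioned on are taken to contain all $P$-null sets of $\mathcal F$ (so the $\sigma$-algebra generated by a mapping includes the $P$-null sets), and "countably generated" means generated by a countable family of sets together with the $P$-null sets. The process $f$ is essentially pairwise exchangeable if there is a Borel probability measure $\pi$ on $(X\times X,\mathcal B\otimes\mathcal B)$ such that for $\lambda$-almost all $i_1\in I$, for $\lambda$-almost all $i_2\in I$, $P(f_{i_1}^{-1}(B_1)\cap f_{i_2}^{-1}(B_2))=\pi(B_1\times B_2)=\pi(B_2\times B_1)$ for all $B_1,B_2\in\mathcal B$. Let $\mathcal C$ be a countably generated sub-$\sigma$-algebra of $\mathcal F$. The process $f$ is essentially i.i.d. conditioned on $\mathcal C$ if (a) for $\lambda$-almost all $i_1\in I$, for $\lambda$-almost all $i_2\in I$, $f_{i_1}$ and $f_{i_2}$ are conditionally independent given $\mathcal C$, i.e. $P(f_{i_1}^{-1}(B_1)\cap f_{i_2}^{-1}(B_2)|\mathcal C)=P(f_{i_1}^{-1}(B_1)|\mathcal C)P(f_{i_2}^{-1}(B_2)|\mathcal C)$ for all $B_1,B_2\in\mathcal B$; and (b) there is a $\mathcal C$-measurable mapping $\omega\mapsto\mu_\omega$ from $\Omega$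 to $\mathcal M(X)$ which, for $\lambda$-almost all $i\in I$, is a regular conditional distribution of $f_i$ given $\mathcal C$. *)

theory Defs
  imports "HOL-Probability.Probability"
begin

definition atomless :: "'a measure \<Rightarrow> bool" where
  "atomless M \<longleftrightarrow>
     (\<forall>A\<in>sets M. 0 < emeasure M A \<longrightarrow>
        (\<exists>B\<in>sets M. B \<subseteq> A \<and> 0 < emeasure M B \<and> emeasure M B < emeasure M A))"

text \<open>
  The inner integrals are defined only almost everywhere. The Bochner integral is \<open>0\<close> at the
  remaining points, and their contribution is irrelevant because the factors are complete.
\<close>

definition fubini_extension :: "'i measure \<Rightarrow> 'w measure \<Rightarrow> ('i \<times> 'w) measure \<Rightarrow> bool" where
  "fubini_extension L P Q \<longleftrightarrow>
     prob_space Q \<and> complete_measure Q \<and>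
     subalgebra Q (L \<Otimes>\<^sub>M P) \<and>
     (\<forall>A\<in>sets (L \<Otimes>\<^sub>M P). emeasure Q A = emeasure (L \<Otimes>\<^sub>M P) A) \<and>
     (\<forall>h :: 'i \<times> 'w \<Rightarrow> real. integrable Q h \<longrightarrow>
        (AE i in L. integrable P (\<lambda>\<omega>. h (i, \<omega>))) \<and>
        (AE \<omega> in P. integrable L (\<lambda>i. h (i, \<omega>))) \<and>
        integrable L (\<lambda>i. \<integral>\<omega>. h (i, \<omega>) \<partial>P) \<and>
        integrable P (\<lambda>\<omega>. \<integral>i. h (i, \<omega>) \<partial>L) \<and>
        integral\<^sup>L Q h = (\<integral>i. (\<integral>\<omega>. h (i, \<omega>) \<partial>P) \<partial>L) \<and>
        integral\<^sup>L Q h = (\<integral>\<omega>. (\<integral>i. h (i, \<omega>) \<partial>L) \<partial>P))"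

definition ess_pairwise_exchangeable ::
  "'i measure \<Rightarrow> 'w measure \<Rightarrow> ('i \<times> 'w \<Rightarrow> 'x::topological_space) \<Rightarrow> bool" where
  "ess_pairwise_exchangeable L P f \<longleftrightarrow>
     (\<exists>\<pi> :: ('x \<times> 'x) measure.
        prob_space \<pi> \<and> sets \<pi> = sets (borel \<Otimes>\<^sub>M borel) \<and>
        (AE i1 in L. AE i2 in L. \<forall>B1\<in>sets borel. \<forall>B2\<in>sets borel.
           measure P {\<omega>\<in>space P. f (i1, \<omega>) \<in> B1 \<and> f (i2, \<omega>) \<in> B2} = measure \<pi> (B1 \<times> B2) \<and>
           measure \<pi> (B1 \<times> B2) = measure \<pi> (B2 \<times> B1)))"

text \<open>
  As in \<^const>\<open>subalgebra\<close>, a sub-\<open>\<sigma>\<close>-algebra is represented by a measure \<open>C\<close> of which only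
  the space and the measurable sets matter. Conditioning \<open>\<sigma>\<close>-algebras contain all null sets.
\<close>

definition countably_generated_subalgebra :: "'w measure \<Rightarrow> 'w measure \<Rightarrow> bool" where
  "countably_generated_subalgebra P C \<longleftrightarrow>
     subalgebra P C \<and>
     (\<exists>G. countable G \<and> G \<subseteq> Pow (space P) \<and> sets C = sigma_sets (space P) (G \<union> null_sets P))"

definition cond_probability :: "'w measure \<Rightarrow> 'w measure \<Rightarrow> 'w set \<Rightarrow> 'w \<Rightarrow> real" where
  "cond_probability P C A = real_cond_exp P C (indicator A)"

definition cond_indep_given ::
  "'w measure \<Rightarrow> 'w measure \<Rightarrow> ('w \<Rightarrow> 'x::topological_space) \<Rightarrow> ('w \<Rightarrow> 'x) \<Rightarrow> bool" where
  "cond_indep_given P C X Y \<longleftrightarrow>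
     X \<in> borel_measurable P \<and> Y \<in> borel_measurable P \<and>
     (\<forall>B1\<in>sets borel. \<forall>B2\<in>sets borel. AE \<omega> in P.
        cond_probability P C ((X -` B1 \<inter> space P) \<inter> (Y -` B2 \<inter> space P)) \<omega> =
        cond_probability P C (X -` B1 \<inter> space P) \<omega> * cond_probability P C (Y -` B2 \<inter> space P) \<omega>)"

text \<open>
  The space of Borel probability measures is \<^term>\<open>prob_algebra borel\<close>; its \<open>\<sigma>\<close>-algebra is
  generated by the evaluations at Borel sets. Over a Polish space this is the Borel
  \<open>\<sigma>\<close>-algebra of the topology of weak convergence.
\<close>

definition regular_cond_distr ::
  "'w measure \<Rightarrow> 'w measure \<Rightarrow> ('w \<Rightarrow> 'x::topological_space) \<Rightarrow> ('w \<Rightarrow> 'x measure) \<Rightarrow> bool" where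
  "regular_cond_distr P C X \<mu> \<longleftrightarrow>
     X \<in> borel_measurable P \<and>
     \<mu> \<in> C \<rightarrow>\<^sub>M prob_algebra borel \<and>
     (\<forall>B\<in>sets borel. AE \<omega> in P.
        measure (\<mu> \<omega>) B = cond_probability P C (X -` B \<inter> space P) \<omega>)"

definition ess_iid_given ::
  "'i measure \<Rightarrow> 'w measure \<Rightarrow> 'w measure \<Rightarrow> ('i \<times> 'w \<Rightarrow> 'x::topological_space) \<Rightarrow> bool" where
  "ess_iid_given L P C f \<longleftrightarrow>
     countably_generated_subalgebra P C \<and>
     (AE i1 in L. AE i2 in L. cond_indep_given P C (\<lambda>\<omega>. f (i1, \<omega>)) (\<lambda>\<omega>. f (i2, \<omega>))) \<and>
     (\<exists>\<mu>. \<mu> \<in> C \<rightarrow>\<^sub>M prob_algebra borel \<and>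
        (AE i in L. regular_cond_distr P C (\<lambda>\<omega>. f (i, \<omega>)) \<mu>))"

text \<open>
  The distribution of the section at \<open>\<omega>\<close> exists only if the section is measurable, which for a
  process on a Fubini extension holds for almost every \<open>\<omega>\<close>. Elsewhere the value is an arbitrary
  fixed Dirac measure, so that the mapping always takes probability measures as values.
\<close>

definition section_distr ::
  "'i measure \<Rightarrow> ('i \<times> 'w \<Rightarrow> 'x::topological_space) \<Rightarrow> 'w \<Rightarrow> 'x measure" where
  "section_distr L f \<omega> =
     (if (\<lambda>i. f (i, \<omega>)) \<in> borel_measurable L then distr L borel (\<lambda>i. f (i, \<omega>))
      else return borel undefined)"

definition generated_algebra :: "'w measure \<Rightarrow> 'y measure \<Rightarrow> ('w \<Rightarrow> 'y) \<Rightarrow> 'w measure" where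
  "generated_algebra P N g =
     sigma (space P) ({g -` A \<inter> space P |A. A \<in> sets N} \<union> null_sets P)"

end

theory Submission
  imports Defs
begin

text \<open>
  Write \<open>\<mu>\<close> for the section distribution and \<open>Y\<^sub>i = 1\<^sub>B(f\<^sub>i) - \<mu>(B)\<close>. Under pairwise exchangeability,
  Fubini shows that \<open>E[1\<^sub>B(f\<^sub>i) \<mu>(B)]\<close> and \<open>E[\<mu>(B)\<^sup>2]\<close> equal \<open>\<pi>(B \<times> B)\<close> for almost all \<open>i\<close>, so the
  \<open>Y\<^sub>i\<close> are almost everywhere pairwise uncorrelated. An \<open>L\<^sup>2\<close> argument then gives \<open>E[Y\<^sub>i 1\<^sub>A] = 0\<close> for
  almost all \<open>i\<close>, for any fixed event \<open>A\<close>. Running through a countable \<open>\<inter>\<close>-stable generator makes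
  the exceptional set independent of \<open>A\<close> in a given countably generated \<open>\<sigma>\<close>-algebra. The
  \<open>\<sigma>\<close>-algebra \<open>C\<close> generated by \<open>\<mu>\<close> yields the regular conditional distribution, and \<open>C\<close> enlarged by
  \<open>f\<^sub>i\<close> yields conditional independence of \<open>f\<^sub>i\<close> and \<open>f\<^sub>j\<close>. Conversely, one takes for \<open>\<pi>\<close> the mixture
  \<open>E[\<mu> \<otimes> \<mu>]\<close>.
\<close>

section \<open>Completeness, countable generators and uniqueness of set integrals\<close>

text \<open>By completeness, a set that agrees almost everywhere with a measurable set is
  measurable. This is needed for functions that Fubini describes only up to a null set.\<close>

lemma (in complete_measure) measurable_AE_cong:
  assumes g: "g \<in> M \<rightarrow>\<^sub>M N" and f: "\<And>x. x \<in> space M \<Longrightarrow> f x \<in> space N"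
    and eq: "AE x in M. f x = g x"
  shows "f \<in> M \<rightarrow>\<^sub>M N"
proof (rule measurableI)
  fix A assume A: "A \<in> sets N"
  have "AE x in M. x \<in> g -` A \<inter> space M \<longleftrightarrow> x \<in> f -` A \<inter> space M"
    using eq by eventually_elim auto
  then show "f -` A \<inter> space M \<in> sets M"
    by (rule in_sets_AE) (use A g in \<open>auto intro: measurable_sets\<close>)
qed (use f in auto)

lemma countable_Int_stable_superset:
  assumes "countable G" "G \<subseteq> Pow \<Omega>"
  obtains H where "countable H" "Int_stable H" "G \<subseteq> H" "\<Omega> \<in> H" "H \<subseteq> sigma_sets \<Omega> G"
proof
  \<comment> \<open>The outer intersection with \<open>\<Omega>\<close> makes the empty family yield
    \<open>\<Omega>\<close>, since \<open>\<Inter>{}\<close> is \<open>UNIV\<close>.\<close>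
  let ?H = "(\<lambda>F. \<Omega> \<inter> \<Inter>F) ` {F. finite F \<and> F \<subseteq> G}"
  show "countable ?H"
    using assms by (intro countable_image countable_Collect_finite_subset)
  show "Int_stable ?H"
  proof (rule Int_stableI, clarsimp)
    fix F F' assume F: "finite F" "F \<subseteq> G" "finite F'" "F' \<subseteq> G"
    show "\<Omega> \<inter> \<Inter> F \<inter> (\<Omega> \<inter> \<Inter> F') \<in> ?H"
      by (rule image_eqI[of _ _ "F \<union> F'"]) (use F in auto)
  qed
  show "G \<subseteq> ?H"
  proof
    fix g assume "g \<in> G"
    then show "g \<in> ?H" using assms(2) by (intro image_eqI[of _ _ "{g}"]) auto
  qed
  show "\<Omega> \<in> ?H" by (rule image_eqI[of _ _ "{}"]) auto
  show "?H \<subseteq> sigma_sets \<Omega> G"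
  proof clarify
    fix F assume "finite F" "F \<subseteq> G"
    then show "\<Omega> \<inter> \<Inter>F \<in> sigma_sets \<Omega> G"
    proof (induction F)
      case empty
      then show ?case by (simp add: sigma_sets_top)
    next
      case (insert g F)
      interpret sigma_algebra \<Omega> "sigma_sets \<Omega> G"
        using assms(2) by (rule sigma_algebra_sigma_sets)
      have "\<Omega> \<inter> \<Inter>(insert g F) = g \<inter> (\<Omega> \<inter> \<Inter>F)" by auto
      then show ?case using insert by auto
    qed
  qed
qed

text \<open>A countable basis is closed under finite intersections. Countability lets
  almost-everywhere statements be combined over the generator; stability under intersections makes
  measures that agree on it equal.\<close>

lemma borel_countable_Int_stable_generator:
  obtains E :: "'a::second_countable_topology set set"
  where "countable E" "Int_stable E" "UNIV \<in> E" "borel = sigma UNIV E"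
proof -
  obtain B :: "'a set set" where B: "countable B" "topological_basis B"
    using ex_countable_basis by auto
  obtain H where H: "countable H" "Int_stable H" "B \<subseteq> H" "UNIV \<in> H" "H \<subseteq> sigma_sets UNIV B"
    using countable_Int_stable_superset[OF B(1), of UNIV] by auto
  have "borel = sigma UNIV B"
    by (rule borel_eq_countable_basis[OF B])
  also have "\<dots> = sigma UNIV H"
    using H by (intro sigma_eqI sigma_sets_eqI) auto
  finally show ?thesis using H that by blast
qed

text \<open>Dynkin's argument: the sets on which the integrals agree are closed under complements,
  because they agree on \<open>space M\<close>, and under countable disjoint unions by countable
  additivity of the integral.\<close>

lemma set_lebesgue_integral_eq_sigma_sets:
  fixes g h :: "'a \<Rightarrow> real"
  assumes int: "integrable M g" "integrable M h"
    and G: "Int_stable G" "G \<subseteq> sets M" "space M \<in> G"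
    and eq: "\<And>A. A \<in> G \<Longrightarrow> (LINT x:A|M. g x) = (LINT x:A|M. h x)"
    and A: "A \<in> sigma_sets (space M) G"
  shows "(LINT x:A|M. g x) = (LINT x:A|M. h x)"
proof -
  have Gs: "G \<subseteq> Pow (space M)" using G(2) sets.sets_into_space by auto
  have sub: "sigma_sets (space M) G \<subseteq> sets M" by (rule sets.sigma_sets_subset[OF G(2)])
  have si: "set_integrable M B u" if "B \<in> sets M" "integrable M u" for B and u :: "'a \<Rightarrow> real"
    using that integrable_mult_indicator[of B M u] by (simp add: set_integrable_def)
  from G(1) Gs A show ?thesis
  proof (induction rule: sigma_sets_induct_disjoint)
    case (basic A)
    then show ?case by (rule eq)
  next
    case empty
    then show ?case by (simp add: set_lebesgue_integral_def)
  next
    case (compl A)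
    then have A: "A \<in> sets M" "A \<subseteq> space M" using sub sets.sets_into_space by auto
    have *: "(LINT x:space M - A|M. u x) = (LINT x:space M|M. u x) - (LINT x:A|M. u x)"
      if u: "integrable M u" for u :: "'a \<Rightarrow> real"
    proof -
      have "(LINT x:(space M - A) \<union> A|M. u x) = (LINT x:space M - A|M. u x) + (LINT x:A|M. u x)"
        by (rule set_integral_Un) (use A u in \<open>auto intro!: si\<close>)
      moreover have "(space M - A) \<union> A = space M" using A by auto
      ultimately show ?thesis by simp
    qed
    show ?case using *[OF int(1)] *[OF int(2)] compl eq[OF G(3)] by simp
  next
    case (union A)
    then have A: "\<And>i. A i \<in> sets M" using sub by auto
    then have "(\<Union>i. A i) \<in> sets M" by auto
    moreover have "disjoint_family A" by (rule union)
    ultimately show ?case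
      using union A int lebesgue_integral_countable_add[where A=A and M=M]
      by (subst (1 2) lebesgue_integral_countable_add)
        (auto intro!: si simp: disjoint_family_on_def)
  qed
qed

text \<open>Integrability is not assumed, because the Bochner integral of a non-integrable function
  is 0. The bound thus also covers the exceptional points at which a section fails to be
  integrable.\<close>

lemma (in prob_space) abs_expectation_le_1:
  fixes u :: "'a \<Rightarrow> real"
  assumes "\<And>x. x \<in> space M \<Longrightarrow> \<bar>u x\<bar> \<le> 1"
  shows "\<bar>expectation u\<bar> \<le> 1"
proof (cases "integrable M u")
  case True
  have "\<bar>expectation u\<bar> \<le> expectation (\<lambda>x. \<bar>u x\<bar>)"
    by (rule integral_abs_bound)
  also have "\<dots> \<le> 1"
    by (rule integral_le_const) (use True assms in auto)
  finally show ?thesis .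
qed (simp add: not_integrable_integral_eq)

section \<open>Sections of a process and measurability of the section distribution\<close>

locale fubini_process =
  L: prob_space L + P: prob_space P + Lc: complete_measure L + Pc: complete_measure P
  for L :: "'i measure" and P :: "'w measure" +
  fixes Q :: "('i \<times> 'w) measure" and f :: "'i \<times> 'w \<Rightarrow> 'x::polish_space"
  assumes ext: "fubini_extension L P Q"
    and f_measurable[measurable]: "f \<in> borel_measurable Q"
begin

sublocale Q: prob_space Q
  using ext by (simp add: fubini_extension_def)

lemma subalgebra_Q: "subalgebra Q (L \<Otimes>\<^sub>M P)"
  using ext by (simp add: fubini_extension_def)

lemma space_Q: "space Q = space L \<times> space P"
  using subalgebra_Q by (simp add: subalgebra_def space_pair_measure)

lemma measurable_fst_Q[measurable]: "fst \<in> Q \<rightarrow>\<^sub>M L"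
  and measurable_snd_Q[measurable]: "snd \<in> Q \<rightarrow>\<^sub>M P"
  using subalgebra_Q by (auto intro: measurable_from_subalg)

lemma integrable_bounded_Q:
  fixes h :: "'i \<times> 'w \<Rightarrow> real"
  assumes "h \<in> borel_measurable Q" "\<And>i \<omega>. i \<in> space L \<Longrightarrow> \<omega> \<in> space P \<Longrightarrow> \<bar>h (i, \<omega>)\<bar> \<le> K"
  shows "integrable Q h"
  by (rule Q.integrable_const_bound[of _ K]) (use assms in \<open>auto simp: space_Q\<close>)

lemma fubini:
  fixes h :: "'i \<times> 'w \<Rightarrow> real"
  assumes "integrable Q h"
  shows "AE i in L. integrable P (\<lambda>\<omega>. h (i, \<omega>))"
    "AE \<omega> in P. integrable L (\<lambda>i. h (i, \<omega>))"
    "integrable L (\<lambda>i. \<integral>\<omega>. h (i, \<omega>) \<partial>P)"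
    "integrable P (\<lambda>\<omega>. \<integral>i. h (i, \<omega>) \<partial>L)"
    "(\<integral>i. (\<integral>\<omega>. h (i, \<omega>) \<partial>P) \<partial>L) = (\<integral>\<omega>. (\<integral>i. h (i, \<omega>) \<partial>L) \<partial>P)"
  using ext assms unfolding fubini_extension_def by metis+

text \<open>Fubini applies to the indicators of a countable generator of the Borel sets. Outside one
  null set the sections of all these indicators are measurable, and a generator suffices to test
  measurability.\<close>

lemma AE_sections_measurable:
  "AE i in L. (\<lambda>\<omega>. f (i, \<omega>)) \<in> borel_measurable P"
  "AE \<omega> in P. (\<lambda>i. f (i, \<omega>)) \<in> borel_measurable L"
proof -
  obtain E :: "'x set set" where E: "countable E" and bor: "borel = sigma UNIV E"
    using borel_countable_Int_stable_generator by metis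
  have int: "integrable Q (\<lambda>z. indicator B (f z) :: real)" if "B \<in> E" for B
  proof (rule integrable_bounded_Q[of _ 1])
    have [measurable]: "B \<in> sets borel" unfolding bor using that by simp
    show "(\<lambda>z. indicator B (f z) :: real) \<in> borel_measurable Q" by measurable
  qed (auto split: split_indicator)
  have meas: "g \<in> borel_measurable M"
    if "\<And>B. B \<in> E \<Longrightarrow> integrable M (\<lambda>x. indicator B (g x) :: real)" for g and M :: "'z measure"
    unfolding bor
  proof (rule measurable_measure_of)
    fix B assume "B \<in> E"
    \<comment> \<open>The preimage of \<open>B\<close> is recovered as the set where its indicator
      takes the value 1.\<close>
    then have "(\<lambda>x. indicator B (g x) :: real) \<in> borel_measurable M" using that by auto
    then have "(\<lambda>x. indicator B (g x) :: real) -` {1} \<inter> space M \<in> sets M"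
      by (rule measurable_sets) auto
    moreover have "(\<lambda>x. indicator B (g x) :: real) -` {1} \<inter> space M = g -` B \<inter> space M"
      by (auto simp: indicator_def)
    ultimately show "g -` B \<inter> space M \<in> sets M" by simp
  qed auto
  have "AE i in L. \<forall>B\<in>E. integrable P (\<lambda>\<omega>. indicator B (f (i, \<omega>)) :: real)"
    by (intro AE_ball_countable') (use E fubini(1)[OF int] in auto)
  then show "AE i in L. (\<lambda>\<omega>. f (i, \<omega>)) \<in> borel_measurable P"
    by eventually_elim (rule meas, auto)
  have "AE \<omega> in P. \<forall>B\<in>E. integrable L (\<lambda>i. indicator B (f (i, \<omega>)) :: real)"
    by (intro AE_ball_countable') (use E fubini(2)[OF int] in auto)
  then show "AE \<omega> in P. (\<lambda>i. f (i, \<omega>)) \<in> borel_measurable L"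
    by eventually_elim (rule meas, auto)
qed

lemma sets_section_distr[simp, measurable_cong]:
  "sets (section_distr L f \<omega>) = sets borel"
  by (simp add: section_distr_def)

lemma prob_space_section_distr: "prob_space (section_distr L f \<omega>)"
  by (auto simp: section_distr_def intro: L.prob_space_distr prob_space_return)

text \<open>Where the section is measurable this is the change of variables formula. That event does
  not involve \<open>B\<close>, so one null set serves all Borel sets.\<close>

lemma AE_measure_section_distr:
  "AE \<omega> in P. \<forall>B\<in>sets borel. measure (section_distr L f \<omega>) B = (\<integral>i. indicator B (f (i, \<omega>)) \<partial>L)"
  using AE_sections_measurable(2)
proof eventually_elim
  case (elim \<omega>)
  show ?case
  proof
    fix B :: "'x set" assume [measurable]: "B \<in> sets borel"
    have "(\<integral>i. indicator B (f (i, \<omega>)) \<partial>L) = (\<integral>x. indicator B x \<partial>distr L borel (\<lambda>i. f (i, \<omega>)) :: real)"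
      using elim by (subst integral_distr) auto
    then show "measure (section_distr L f \<omega>) B = (\<integral>i. indicator B (f (i, \<omega>)) \<partial>L)"
      using elim by (simp add: section_distr_def)
  qed
qed

lemma integrable_indicator_process:
  assumes [measurable]: "B \<in> sets borel"
  shows "integrable Q (\<lambda>z. indicator B (f z) :: real)"
  by (rule integrable_bounded_Q[of _ 1]) (auto split: split_indicator)

text \<open>Evaluation at \<open>B\<close> agrees almost everywhere with an inner integral that
  Fubini makes measurable. Completeness of \<open>P\<close> transfers measurability, whatever values
  are taken on the null set.\<close>

lemma measurable_section_distr[measurable]:
  "section_distr L f \<in> P \<rightarrow>\<^sub>M prob_algebra borel"
proof (rule measurable_prob_algebra_generated[where \<Omega>=UNIV and G="sets borel"])
  fix B :: "'x set" assume B: "B \<in> sets borel"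
  have "(\<lambda>\<omega>. measure (section_distr L f \<omega>) B) \<in> borel_measurable P"
  proof (rule Pc.measurable_AE_cong)
    show "(\<lambda>\<omega>. \<integral>i. indicator B (f (i, \<omega>)) \<partial>L :: real) \<in> borel_measurable P"
      using fubini(4)[OF integrable_indicator_process[OF B]] by (rule borel_measurable_integrable)
  qed (use AE_measure_section_distr B in auto)
  then show "(\<lambda>\<omega>. emeasure (section_distr L f \<omega>) B) \<in> borel_measurable P"
    by (simp add: finite_measure.emeasure_eq_measure[OF prob_space.finite_measure[OF prob_space_section_distr]])
qed (auto simp: Int_stable_def sets.sigma_sets_eq[of borel, simplified] prob_space_section_distr)

lemma measurable_measure_section_distr[measurable]:
  "B \<in> sets borel \<Longrightarrow> (\<lambda>\<omega>. measure (section_distr L f \<omega>) B) \<in> borel_measurable P"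
  using measurable_compose[OF measurable_section_distr measurable_measure_prob_algebra] .

section \<open>Uncorrelated centred indicators and orthogonality\<close>

text \<open>
  With \<open>g i = E[Y\<^sub>i Z]\<close> and \<open>W = \<integral>g i Y\<^sub>i d\<lambda>\<close>, Fubini gives \<open>\<integral>g\<^sup>2 d\<lambda> = E[Z W]\<close>,
  while \<open>E[W\<^sup>2] = 0\<close> because the \<open>Y\<^sub>i\<close> are uncorrelated.
\<close>
lemma AE_orthogonal_of_uncorrelated:
  fixes Y :: "'i \<times> 'w \<Rightarrow> real"
  assumes Y[measurable]: "Y \<in> borel_measurable Q"
    and Y1: "\<And>i \<omega>. i \<in> space L \<Longrightarrow> \<omega> \<in> space P \<Longrightarrow> \<bar>Y (i, \<omega>)\<bar> \<le> 1"
    and uncor: "AE i in L. AE j in L. (\<integral>\<omega>. Y (i, \<omega>) * Y (j, \<omega>) \<partial>P) = 0"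
    and Z[measurable]: "Z \<in> borel_measurable P"
    and Z1: "\<And>\<omega>. \<omega> \<in> space P \<Longrightarrow> \<bar>Z \<omega>\<bar> \<le> 1"
  shows "AE i in L. (\<integral>\<omega>. Y (i, \<omega>) * Z \<omega> \<partial>P) = 0"
proof -
  define g where "g i = (\<integral>\<omega>. Y (i, \<omega>) * Z \<omega> \<partial>P)" for i
  define W where "W \<omega> = (\<integral>i. g i * Y (i, \<omega>) \<partial>L)" for \<omega>
  have g1: "\<bar>g i\<bar> \<le> 1" if "i \<in> space L" for i
    unfolding g_def by (rule P.abs_expectation_le_1) (use that Y1 Z1 in \<open>auto simp: abs_mult intro!: mult_le_one\<close>)
  have W1: "\<bar>W \<omega>\<bar> \<le> 1" if "\<omega> \<in> space P" for \<omega>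
    unfolding W_def by (rule L.abs_expectation_le_1) (use that Y1 g1 in \<open>auto simp: abs_mult intro!: mult_le_one\<close>)
  have "integrable Q (\<lambda>z. Y z * Z (snd z))"
    by (rule integrable_bounded_Q[of _ 1]) (use Y1 Z1 in \<open>auto simp: abs_mult intro!: mult_le_one\<close>)
  \<comment> \<open>Measurability of \<open>g\<close>, and below of \<open>W\<close>, is part of the
    Fubini property. Hence products such as \<open>g (fst z) * Y z\<close> may be fed back into
    it.\<close>
  from fubini(3)[OF this] have g[measurable]: "g \<in> borel_measurable L"
    by (simp add: g_def[abs_def])
  have gY: "integrable Q (\<lambda>z. g (fst z) * Y z)"
    by (rule integrable_bounded_Q[of _ 1]) (use Y1 g1 in \<open>auto simp: abs_mult intro!: mult_le_one\<close>)
  from fubini(4)[OF this] have W[measurable]: "W \<in> borel_measurable P"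
    by (simp add: W_def[abs_def])
  \<comment> \<open>Applied below with \<open>V\<close> equal to \<open>Y (i, _)\<close>, then
    \<open>W\<close>, then \<open>Z\<close>.\<close>
  have swap: "(\<integral>i. g i * (\<integral>\<omega>. Y (i, \<omega>) * V \<omega> \<partial>P) \<partial>L) = (\<integral>\<omega>. V \<omega> * W \<omega> \<partial>P)"
    if [measurable]: "V \<in> borel_measurable P" and V1: "\<And>\<omega>. \<omega> \<in> space P \<Longrightarrow> \<bar>V \<omega>\<bar> \<le> 1" for V
  proof -
    have "integrable Q (\<lambda>z. g (fst z) * (Y z * V (snd z)))"
      by (rule integrable_bounded_Q[of _ 1]) (use Y1 g1 V1 in \<open>auto simp: abs_mult intro!: mult_le_one\<close>)
    from fubini(5)[OF this]
    have "(\<integral>i. g i * (\<integral>\<omega>. Y (i, \<omega>) * V \<omega> \<partial>P) \<partial>L) = (\<integral>\<omega>. (\<integral>i. (g i * Y (i, \<omega>)) * V \<omega> \<partial>L) \<partial>P)"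
      by (simp add: mult.assoc)
    then show ?thesis by (simp add: W_def mult.commute[of "V _"])
  qed
  have intY: "integrable Q Y" by (rule integrable_bounded_Q[OF Y Y1])
  have "AE i in L. (\<integral>\<omega>. Y (i, \<omega>) * W \<omega> \<partial>P) = 0"
    using uncor fubini(1)[OF intY] AE_space
  proof eventually_elim
    case (elim i)
    then have [measurable]: "(\<lambda>\<omega>. Y (i, \<omega>)) \<in> borel_measurable P" by auto
    have "(\<integral>\<omega>. Y (i, \<omega>) * W \<omega> \<partial>P) = (\<integral>j. g j * (\<integral>\<omega>. Y (j, \<omega>) * Y (i, \<omega>) \<partial>P) \<partial>L)"
      by (subst swap) (use Y1 elim in auto)
    also have "\<dots> = 0"
      by (rule integral_eq_zero_AE, use elim(1) in eventually_elim) (simp add: mult.commute)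
    finally show ?case .
  qed
  then have "(\<integral>i. g i * (\<integral>\<omega>. Y (i, \<omega>) * W \<omega> \<partial>P) \<partial>L) = 0"
    by (intro integral_eq_zero_AE) auto
  then have "(\<integral>\<omega>. W \<omega> * W \<omega> \<partial>P) = 0" by (simp add: swap W1)
  moreover have "integrable P (\<lambda>\<omega>. W \<omega> * W \<omega>)"
  proof (intro P.integrable_const_bound[of _ 1] AE_I2)
    fix \<omega> assume "\<omega> \<in> space P"
    then show "norm (W \<omega> * W \<omega>) \<le> 1"
      using mult_le_one[OF W1[of \<omega>] abs_ge_zero W1[of \<omega>]] by (simp add: abs_mult)
  qed measurable
  ultimately have "AE \<omega> in P. W \<omega> = 0"
    by (subst (asm) integral_nonneg_eq_0_iff_AE) auto
  then have "(\<integral>\<omega>. Z \<omega> * W \<omega> \<partial>P) = 0"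
    by (intro integral_eq_zero_AE) auto
  then have "(\<integral>i. g i * g i \<partial>L) = 0"
    using swap[OF Z Z1] by (simp add: g_def)
  moreover have "integrable L (\<lambda>i. g i * g i)"
  proof (intro L.integrable_const_bound[of _ 1] AE_I2)
    fix i assume "i \<in> space L"
    then show "norm (g i * g i) \<le> 1"
      using mult_le_one[OF g1[of i] abs_ge_zero g1[of i]] by (simp add: abs_mult)
  qed measurable
  ultimately have "AE i in L. g i = 0"
    by (subst (asm) integral_nonneg_eq_0_iff_AE) auto
  then show ?thesis by (simp add: g_def)
qed

lemma measure_section_distr_le_1[simp]: "measure (section_distr L f \<omega>) B \<le> 1"
  using prob_space.prob_le_1[OF prob_space_section_distr] .

text \<open>Expanding the product leaves four expectations. All of them equal one constant
  \<open>c\<close>, so they cancel.\<close>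

lemma AE_uncorrelated:
  assumes exch: "ess_pairwise_exchangeable L P f" and B[measurable]: "B \<in> sets borel"
  defines "Y \<equiv> \<lambda>z. indicator B (f z) - measure (section_distr L f (snd z)) B :: real"
  shows "AE i in L. AE j in L. (\<integral>\<omega>. Y (i, \<omega>) * Y (j, \<omega>) \<partial>P) = 0"
proof -
  define \<phi> :: "'i \<times> 'w \<Rightarrow> real" where "\<phi> z = indicator B (f z)" for z
  define m where "m \<omega> = measure (section_distr L f \<omega>) B" for \<omega>
  have \<phi>[measurable]: "\<phi> \<in> borel_measurable Q" unfolding \<phi>_def by measurable
  have m[measurable]: "m \<in> borel_measurable P" unfolding m_def by measurable
  have \<phi>1: "\<bar>\<phi> z\<bar> \<le> 1" for z by (simp add: \<phi>_def)
  have m1: "\<bar>m \<omega>\<bar> \<le> 1" for \<omega> by (simp add: m_def)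
  have m_eq: "AE \<omega> in P. (\<integral>i. \<phi> (i, \<omega>) \<partial>L) = m \<omega>"
    using AE_measure_section_distr by eventually_elim (simp add: \<phi>_def m_def B)
  have \<phi>_meas: "AE i in L. (\<lambda>\<omega>. \<phi> (i, \<omega>)) \<in> borel_measurable P"
    using AE_sections_measurable(1)
  proof eventually_elim
    case (elim i)
    then show ?case unfolding \<phi>_def by measurable
  qed
  \<comment> \<open>In an expectation against a bounded weight \<open>V\<close>, averaging
    \<open>\<phi> (j, \<omega>)\<close> over \<open>j\<close> replaces it by the section mean
    \<open>m \<omega>\<close>.\<close>
  have swap: "(\<integral>j. (\<integral>\<omega>. V \<omega> * \<phi> (j, \<omega>) \<partial>P) \<partial>L) = (\<integral>\<omega>. V \<omega> * m \<omega> \<partial>P)"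
    "(\<lambda>j. \<integral>\<omega>. V \<omega> * \<phi> (j, \<omega>) \<partial>P) \<in> borel_measurable L"
    if [measurable]: "V \<in> borel_measurable P" and V1: "\<And>\<omega>. \<bar>V \<omega>\<bar> \<le> 1" for V
  proof -
    have int: "integrable Q (\<lambda>z. V (snd z) * \<phi> z)"
      by (rule integrable_bounded_Q[of _ 1]) (use \<phi>1 V1 in \<open>auto simp: abs_mult intro!: mult_le_one\<close>)
    have "(\<integral>j. (\<integral>\<omega>. V \<omega> * \<phi> (j, \<omega>) \<partial>P) \<partial>L) = (\<integral>\<omega>. (\<integral>j. V \<omega> * \<phi> (j, \<omega>) \<partial>L) \<partial>P)"
      using fubini(5)[OF int] by simp
    also have "\<dots> = (\<integral>\<omega>. V \<omega> * m \<omega> \<partial>P)"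
    proof (rule integral_cong_AE)
      show "(\<lambda>\<omega>. \<integral>j. V \<omega> * \<phi> (j, \<omega>) \<partial>L) \<in> borel_measurable P"
        using fubini(4)[OF int] by simp
      show "AE \<omega> in P. (\<integral>j. V \<omega> * \<phi> (j, \<omega>) \<partial>L) = V \<omega> * m \<omega>"
        using m_eq by eventually_elim simp
    qed measurable
    finally show "(\<integral>j. (\<integral>\<omega>. V \<omega> * \<phi> (j, \<omega>) \<partial>P) \<partial>L) = (\<integral>\<omega>. V \<omega> * m \<omega> \<partial>P)" .
    show "(\<lambda>j. \<integral>\<omega>. V \<omega> * \<phi> (j, \<omega>) \<partial>P) \<in> borel_measurable L"
      using fubini(3)[OF int] by simp
  qed
  \<comment> \<open>A value shared by almost all \<open>j\<close> is unchanged by averaging over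
    \<open>j\<close>.\<close>
  have const: "(\<integral>\<omega>. V \<omega> * m \<omega> \<partial>P) = c"
    if V: "V \<in> borel_measurable P" "\<And>\<omega>. \<bar>V \<omega>\<bar> \<le> 1"
      and c: "AE j in L. (\<integral>\<omega>. V \<omega> * \<phi> (j, \<omega>) \<partial>P) = c" for V c
  proof -
    have "(\<integral>j. (\<integral>\<omega>. V \<omega> * \<phi> (j, \<omega>) \<partial>P) \<partial>L) = (\<integral>j. c \<partial>L)"
      using c by (intro integral_cong_AE swap(2)[OF V]) auto
    then show ?thesis using swap(1)[OF V] by (simp add: L.prob_space)
  qed
  \<comment> \<open>The constant is the value of \<open>\<pi>\<close> at the square
    \<open>B \<times> B\<close>.\<close>
  obtain c where c: "AE i in L. AE j in L. measure P {\<omega>\<in>space P. f (i, \<omega>) \<in> B \<and> f (j, \<omega>) \<in> B} = c"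
  proof -
    obtain \<pi> :: "('x \<times> 'x) measure" where *: "AE i1 in L. AE i2 in L. \<forall>B1\<in>sets borel. \<forall>B2\<in>sets borel.
           measure P {\<omega>\<in>space P. f (i1, \<omega>) \<in> B1 \<and> f (i2, \<omega>) \<in> B2} = measure \<pi> (B1 \<times> B2) \<and>
           measure \<pi> (B1 \<times> B2) = measure \<pi> (B2 \<times> B1)"
      using exch unfolding ess_pairwise_exchangeable_def by auto
    show ?thesis
    proof (rule that[of "measure \<pi> (B \<times> B)"], use * in eventually_elim)
      case (elim i)
      then show ?case by eventually_elim (simp add: B)
    qed
  qed
  have pair: "AE i in L. AE j in L. (\<integral>\<omega>. \<phi> (i, \<omega>) * \<phi> (j, \<omega>) \<partial>P) = c"
    using c
  proof eventually_elim
    case (elim i)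
    then show ?case
    proof eventually_elim
      case (elim j)
      have "(\<integral>\<omega>. \<phi> (i, \<omega>) * \<phi> (j, \<omega>) \<partial>P) = (\<integral>\<omega>. indicator {\<omega>\<in>space P. f (i, \<omega>) \<in> B \<and> f (j, \<omega>) \<in> B} \<omega> \<partial>P)"
        by (intro Bochner_Integration.integral_cong) (auto simp: \<phi>_def indicator_def)
      also have "\<dots> = measure P ({\<omega>\<in>space P. f (i, \<omega>) \<in> B \<and> f (j, \<omega>) \<in> B} \<inter> space P)"
        by simp
      also have "{\<omega>\<in>space P. f (i, \<omega>) \<in> B \<and> f (j, \<omega>) \<in> B} \<inter> space P = {\<omega>\<in>space P. f (i, \<omega>) \<in> B \<and> f (j, \<omega>) \<in> B}"
        by auto
      finally show ?case using elim by simp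
    qed
  qed
  \<comment> \<open>Here \<open>const\<close> averages out \<open>j\<close>, with \<open>V\<close>
    equal to \<open>\<phi> (i, _)\<close>. In \<open>mm\<close> it averages out \<open>i\<close>,
    with \<open>V\<close> equal to \<open>m\<close>.\<close>
  have \<phi>m: "AE i in L. (\<integral>\<omega>. \<phi> (i, \<omega>) * m \<omega> \<partial>P) = c"
    using pair \<phi>_meas by eventually_elim (rule const, auto simp: \<phi>1)
  have mm: "(\<integral>\<omega>. m \<omega> * m \<omega> \<partial>P) = c"
    using \<phi>m by (intro const m m1) (simp add: mult.commute)
  from pair \<phi>m \<phi>_meas show ?thesis
  proof eventually_elim
    case (elim i)
    note i = elim(2,3)
    from elim(1) \<phi>m \<phi>_meas show ?case
    proof eventually_elim
      case (elim j)
      have int: "integrable P (\<lambda>\<omega>. u \<omega> * v \<omega>)"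
        if "u \<in> borel_measurable P" "v \<in> borel_measurable P" "\<And>\<omega>. \<bar>u \<omega>\<bar> \<le> 1" "\<And>\<omega>. \<bar>v \<omega>\<bar> \<le> 1"
        for u v :: "'w \<Rightarrow> real"
        by (rule P.integrable_const_bound[of _ 1]) (use that in \<open>auto simp: abs_mult intro!: mult_le_one\<close>)
      \<comment> \<open>The bracketing presents the product as differences of four integrable terms,
        each with integral \<open>c\<close>.\<close>
      have "(\<integral>\<omega>. Y (i, \<omega>) * Y (j, \<omega>) \<partial>P) =
        (\<integral>\<omega>. (\<phi> (i, \<omega>) * \<phi> (j, \<omega>) - \<phi> (i, \<omega>) * m \<omega>) - (\<phi> (j, \<omega>) * m \<omega> - m \<omega> * m \<omega>) \<partial>P)"
        by (simp add: Y_def \<phi>_def m_def algebra_simps)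
      also have "\<dots> = (c - c) - (c - c)"
        using elim i mm int m m1 \<phi>1 by simp
      finally show ?case by simp
    qed
  qed
qed

section \<open>Equality of integrals over a countably generated sub-\<sigma>-algebra\<close>

text \<open>Orthogonality with \<open>Z\<close> the indicator of \<open>A\<close>. The exceptional
  set of indices may still depend on \<open>A\<close> and \<open>B\<close>.\<close>

lemma AE_set_integral_section_distr:
  assumes exch: "ess_pairwise_exchangeable L P f"
    and B[measurable]: "B \<in> sets borel" and A[measurable]: "A \<in> sets P"
  shows "AE i in L. (LINT \<omega>:A|P. indicator B (f (i, \<omega>))) = (LINT \<omega>:A|P. measure (section_distr L f \<omega>) B)"
proof -
  let ?m = "\<lambda>\<omega>. measure (section_distr L f \<omega>) B"
  let ?Y = "\<lambda>z. indicator B (f z) - ?m (snd z) :: real"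
  have "AE i in L. (\<integral>\<omega>. ?Y (i, \<omega>) * indicator A \<omega> \<partial>P) = 0"
  proof (rule AE_orthogonal_of_uncorrelated)
    show "\<bar>?Y (i, \<omega>)\<bar> \<le> 1" for i \<omega>
      using measure_section_distr_le_1[of \<omega> B] measure_nonneg[of "section_distr L f \<omega>" B]
      by (auto simp: indicator_def abs_le_iff simp del: measure_section_distr_le_1 measure_nonneg)
  qed (use AE_uncorrelated[OF exch B] in auto)
  then show ?thesis
    using AE_sections_measurable(1)
  proof eventually_elim
    case (elim i)
    note [measurable] = elim(2)
    have "integrable P (\<lambda>\<omega>. indicator A \<omega> * indicator B (f (i, \<omega>)) :: real)"
      "integrable P (\<lambda>\<omega>. indicator A \<omega> * ?m \<omega>)"
      by (rule P.integrable_const_bound[of _ 1]; auto simp: abs_mult intro!: mult_le_one)+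
    then show ?case using elim(1)
      by (simp add: set_lebesgue_integral_def algebra_simps)
  qed
qed

text \<open>The exceptional set is made uniform: countably many pairs from intersection-stable
  generators share one null set of indices, and for each remaining index the identity extends first
  in \<open>A\<close>, then in \<open>B\<close>.\<close>

lemma AE_set_integral_section_distr_sigma_sets:
  assumes exch: "ess_pairwise_exchangeable L P f"
    and G: "countable G" "G \<subseteq> sets P"
  shows "AE i in L. \<forall>A\<in>sigma_sets (space P) (G \<union> null_sets P). \<forall>B\<in>sets borel.
    (LINT \<omega>:A|P. indicator B (f (i, \<omega>))) = (LINT \<omega>:A|P. measure (section_distr L f \<omega>) B)"
proof -
  obtain E :: "'x set set" where E: "countable E" "Int_stable E" "UNIV \<in> E" and bor: "borel = sigma UNIV E"
    using borel_countable_Int_stable_generator by metis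
  have sets_bor: "sets borel = sigma_sets UNIV E"
    by (subst bor) simp
  have GP: "G \<subseteq> Pow (space P)" using G(2) sets.sets_into_space by auto
  obtain H where H: "countable H" "Int_stable H" "G \<subseteq> H" "space P \<in> H" "H \<subseteq> sigma_sets (space P) G"
    using countable_Int_stable_superset[OF G(1) GP] .
  have HP: "H \<subseteq> sets P" using H(5) sets.sigma_sets_subset[OF G(2)] by auto
  have "AE i in L. \<forall>A\<in>H. \<forall>B\<in>E.
    (LINT \<omega>:A|P. indicator B (f (i, \<omega>))) = (LINT \<omega>:A|P. measure (section_distr L f \<omega>) B)"
  proof (intro AE_ball_countable' H(1) E(1) AE_set_integral_section_distr[OF exch])
    show "B \<in> sets borel" if "B \<in> E" for B using that by (auto simp: sets_bor)
    show "A \<in> sets P" if "A \<in> H" for A using that HP by auto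
  qed
  then show ?thesis
    using AE_sections_measurable(1)
  proof (eventually_elim, intro ballI)
    fix i A and B :: "'x set"
    assume base: "\<forall>A\<in>H. \<forall>B\<in>E.
        (LINT \<omega>:A|P. indicator B (f (i, \<omega>))) = (LINT \<omega>:A|P. measure (section_distr L f \<omega>) B)"
      and fi[measurable]: "(\<lambda>\<omega>. f (i, \<omega>)) \<in> borel_measurable P"
      and A: "A \<in> sigma_sets (space P) (G \<union> null_sets P)" and B: "B \<in> sets borel"
    have GH: "G \<union> null_sets P \<subseteq> H \<union> null_sets P" "H \<union> null_sets P \<subseteq> sets P"
      using H HP by auto
    have A': "A \<in> sigma_sets (space P) (H \<union> null_sets P)"
      using A sigma_sets_mono'[OF GH(1)] by auto
    then have AP[measurable]: "A \<in> sets P" using sets.sigma_sets_subset[OF GH(2)] by auto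
    \<comment> \<open>Extension in \<open>A\<close> with \<open>B\<close> in \<open>E\<close> fixed.
      Adding the null sets keeps the generator stable under intersections, and over a null set both
      integrals vanish.\<close>
    have on_E: "(LINT \<omega>:A|P. indicator B (f (i, \<omega>))) = (LINT \<omega>:A|P. measure (section_distr L f \<omega>) B)"
      if BE: "B \<in> E" for B
    proof (rule set_lebesgue_integral_eq_sigma_sets[OF _ _ _ GH(2) _ _ A'])
      have [measurable]: "B \<in> sets borel" using BE by (auto simp: sets_bor)
      show "integrable P (\<lambda>\<omega>. indicator B (f (i, \<omega>)) :: real)"
        by (rule P.integrable_const_bound[of _ 1]) auto
      show "integrable P (\<lambda>\<omega>. measure (section_distr L f \<omega>) B)"
        by (rule P.integrable_const_bound[of _ 1]) auto
      show "Int_stable (H \<union> null_sets P)"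
        using H(2) HP by (auto simp: Int_stable_def intro: null_set_Int1 null_set_Int2)
      show "space P \<in> H \<union> null_sets P" using H by auto
      fix N assume "N \<in> H \<union> null_sets P"
      then show "(LINT \<omega>:N|P. indicator B (f (i, \<omega>))) = (LINT \<omega>:N|P. measure (section_distr L f \<omega>) B)"
      proof
        assume "N \<in> null_sets P"
        then have N: "AE \<omega> in P. indicator N \<omega> = (0::real)"
          using AE_not_in[of N P] by (auto elim: eventually_mono)
        have "(LINT \<omega>:N|P. u \<omega>) = 0" for u :: "'w \<Rightarrow> real"
          unfolding set_lebesgue_integral_def
          by (rule integral_eq_zero_AE, use N in eventually_elim) simp
        then show ?thesis by simp
      qed (use base BE in auto)
    qed
    \<comment> \<open>Extension in \<open>B\<close> with \<open>A\<close> fixed. Both sides are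
      values at \<open>B\<close> of finite measures: the law of the section at \<open>i\<close>
      under \<open>P\<close> restricted to \<open>A\<close>, and the mixture of section
      distributions over \<open>A\<close>.\<close>
    define M1 where "M1 = distr (density P (indicator A)) borel (\<lambda>\<omega>. f (i, \<omega>))"
    define M2 where "M2 = density P (indicator A) \<bind> section_distr L f"
    have \<mu>: "section_distr L f \<in> density P (indicator A) \<rightarrow>\<^sub>M subprob_algebra borel"
      using measurable_prob_algebraD[OF measurable_section_distr] by simp
    have M1: "emeasure M1 B = ennreal (LINT \<omega>:A|P. indicator B (f (i, \<omega>)))"
      if [measurable]: "B \<in> sets borel" for B
    proof -
      have "emeasure M1 B = emeasure (density P (indicator A)) ((\<lambda>\<omega>. f (i, \<omega>)) -` B \<inter> space P)"
        unfolding M1_def by (subst emeasure_distr) auto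
      also have "\<dots> = (\<integral>\<^sup>+\<omega>. ennreal (indicator A \<omega> * indicator B (f (i, \<omega>))) \<partial>P)"
        by (subst emeasure_density) (auto intro!: nn_integral_cong simp: indicator_def)
      also have "\<dots> = ennreal (\<integral>\<omega>. indicator A \<omega> * indicator B (f (i, \<omega>)) \<partial>P)"
        by (intro nn_integral_eq_integral P.integrable_const_bound[of _ 1])
          (auto simp: abs_mult intro!: mult_le_one)
      finally show ?thesis by (simp add: set_lebesgue_integral_def)
    qed
    have M2: "emeasure M2 B = ennreal (LINT \<omega>:A|P. measure (section_distr L f \<omega>) B)"
      if [measurable]: "B \<in> sets borel" for B
    proof -
      have "emeasure M2 B = (\<integral>\<^sup>+\<omega>. emeasure (section_distr L f \<omega>) B \<partial>density P (indicator A))"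
        unfolding M2_def by (rule emeasure_bind[OF _ \<mu>]) (auto simp: P.not_empty)
      also have "\<dots> = (\<integral>\<^sup>+\<omega>. indicator A \<omega> * emeasure (section_distr L f \<omega>) B \<partial>P)"
        using \<mu> by (subst nn_integral_density) auto
      also have "\<dots> = (\<integral>\<^sup>+\<omega>. ennreal (indicator A \<omega> * measure (section_distr L f \<omega>) B) \<partial>P)"
        by (intro nn_integral_cong)
          (auto simp: indicator_def finite_measure.emeasure_eq_measure[OF prob_space.finite_measure[OF prob_space_section_distr]])
      also have "\<dots> = ennreal (\<integral>\<omega>. indicator A \<omega> * measure (section_distr L f \<omega>) B \<partial>P)"
        by (intro nn_integral_eq_integral P.integrable_const_bound[of _ 1])
          (auto simp: abs_mult intro!: mult_le_one)
      finally show ?thesis by (simp add: set_lebesgue_integral_def)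
    qed
    have "M1 = M2"
    proof (rule measure_eqI_generator_eq[OF E(2), where \<Omega>=UNIV and A="\<lambda>_. UNIV"])
      show "sets M1 = sigma_sets UNIV E" by (simp add: M1_def sets_bor)
      show "sets M2 = sigma_sets UNIV E"
        unfolding M2_def using P.not_empty by (subst sets_bind[where N=borel]) (auto simp: sets_bor)
      show "emeasure M1 X = emeasure M2 X" if "X \<in> E" for X
        using that on_E[OF that] by (simp add: M1 M2 sets_bor)
      show "emeasure M1 UNIV \<noteq> \<infinity>" by (simp add: M1)
    qed (use E in auto)
    then have "ennreal (LINT \<omega>:A|P. indicator B (f (i, \<omega>))) = ennreal (LINT \<omega>:A|P. measure (section_distr L f \<omega>) B)"
      using M1[OF B] M2[OF B] by simp
    then show "(LINT \<omega>:A|P. indicator B (f (i, \<omega>))) = (LINT \<omega>:A|P. measure (section_distr L f \<omega>) B)"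
      by (subst (asm) ennreal_inj) (auto simp: set_lebesgue_integral_def intro!: integral_nonneg_AE)
  qed
qed

section \<open>The \<sigma>-algebra generated by the section distribution\<close>

abbreviation "C \<equiv> generated_algebra P (prob_algebra borel) (section_distr L f)"

lemma space_C: "space C = space P"
  and sets_C: "sets C = sigma_sets (space P)
    ({section_distr L f -` A \<inter> space P |A. A \<in> sets (prob_algebra borel)} \<union> null_sets P)"
proof -
  have "{section_distr L f -` A \<inter> space P |A. A \<in> sets (prob_algebra borel)} \<union> null_sets P \<subseteq> Pow (space P)"
    using sets.sets_into_space[of _ P] by auto
  from space_measure_of[OF this] sets_measure_of[OF this]
  show "space C = space P"
    "sets C = sigma_sets (space P)
      ({section_distr L f -` A \<inter> space P |A. A \<in> sets (prob_algebra borel)} \<union> null_sets P)"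
    by (simp_all add: generated_algebra_def)
qed

lemma subalgebra_C: "subalgebra P C"
proof -
  have "{section_distr L f -` A \<inter> space P |A. A \<in> sets (prob_algebra borel)} \<union> null_sets P \<subseteq> sets P"
    using measurable_section_distr by (auto intro: measurable_sets)
  from sets.sigma_sets_subset[OF this] show ?thesis
    by (simp add: subalgebra_def space_C sets_C)
qed

lemma section_distr_measurable_C[measurable]: "section_distr L f \<in> C \<rightarrow>\<^sub>M prob_algebra borel"
proof (rule measurableI)
  show "section_distr L f \<omega> \<in> space (prob_algebra borel)" for \<omega>
    by (simp add: space_prob_algebra prob_space_section_distr)
  fix A :: "'x measure set" assume "A \<in> sets (prob_algebra borel)"
  then show "section_distr L f -` A \<inter> space C \<in> sets C"
    unfolding space_C sets_C by (intro sigma_sets.Basic) auto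
qed

text \<open>A map into the space of probability measures is measurable once its evaluations on an
  intersection-stable generator \<open>E\<close> are. Preimages under these real-valued evaluations
  need only be taken for a countable generator \<open>R\<close> of the real Borel sets, so pairs
  from \<open>E\<close> and \<open>R\<close> suffice.\<close>

lemma C_countable_generator:
  obtains G where "countable G" "G \<subseteq> sets P" "sets C = sigma_sets (space P) (G \<union> null_sets P)"
proof -
  obtain E :: "'x set set" where E: "countable E" "Int_stable E" "UNIV \<in> E" and bor: "borel = sigma UNIV E"
    using borel_countable_Int_stable_generator by metis
  obtain R :: "real set set" where R: "countable R" and borR: "borel = sigma UNIV R"
    using borel_countable_Int_stable_generator by metis
  have sets_bor: "sets borel = sigma_sets UNIV E" "sets borel = sigma_sets UNIV R"
    by (subst bor borR, simp)+
  define m where "m B \<omega> = measure (section_distr L f \<omega>) B" for B \<omega>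
  define G where "G = (\<lambda>(B, U). m B -` U \<inter> space P) ` (E \<times> R)"
  define S where "S = sigma (space P) (G \<union> null_sets P)"
  have G_C: "G \<subseteq> sets C"
  proof (clarsimp simp: G_def)
    fix B U assume "B \<in> E" "U \<in> R"
    then have B: "B \<in> sets borel" and U: "U \<in> sets borel" by (auto simp: sets_bor)
    have "m B \<in> borel_measurable C"
      using measurable_compose[OF section_distr_measurable_C measurable_measure_prob_algebra[OF B]]
      by (simp add: m_def[abs_def])
    from measurable_sets[OF this U] show "m B -` U \<inter> space P \<in> sets C"
      by (simp add: space_C)
  qed
  moreover have nC: "null_sets P \<subseteq> sets C" by (auto simp: sets_C intro!: sigma_sets.Basic)
  ultimately have 1: "sigma_sets (space P) (G \<union> null_sets P) \<subseteq> sets C"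
    using sets.sigma_sets_subset[of "G \<union> null_sets P" C] by (simp add: space_C)
  have G_P: "G \<subseteq> sets P" using G_C subalgebra_C by (auto simp: subalgebra_def)
  then have Pow: "G \<union> null_sets P \<subseteq> Pow (space P)" using sets.sets_into_space[of _ P] by auto
  have S: "space S = space P" "sets S = sigma_sets (space P) (G \<union> null_sets P)"
    using Pow by (simp_all add: S_def)
  \<comment> \<open>This gives the inclusion of \<open>sets C\<close> in \<open>sets S\<close>; the
    converse is \<open>1\<close>.\<close>
  have "section_distr L f \<in> S \<rightarrow>\<^sub>M prob_algebra borel"
  proof (rule measurable_prob_algebra_generated[OF sets_bor(1) E(2)])
    fix B assume B: "B \<in> E"
    have "m B \<in> borel_measurable S"
      unfolding borR
    proof (rule measurable_measure_of)
      show "m B -` U \<inter> space S \<in> sets S" if "U \<in> R" for U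
        unfolding S using that B by (intro sigma_sets.Basic) (auto simp: G_def)
    qed auto
    then show "(\<lambda>\<omega>. emeasure (section_distr L f \<omega>) B) \<in> borel_measurable S"
      by (simp add: m_def[abs_def] finite_measure.emeasure_eq_measure[OF prob_space.finite_measure[OF prob_space_section_distr]])
  qed (auto simp: prob_space_section_distr)
  then have "{section_distr L f -` A \<inter> space P |A. A \<in> sets (prob_algebra borel)} \<union> null_sets P \<subseteq> sets S"
    by (auto simp flip: S(1) intro: measurable_sets) (auto simp: S intro: sigma_sets.Basic)
  from sets.sigma_sets_subset[OF this] have "sets C \<subseteq> sets S"
    by (simp add: sets_C S)
  then have "sets C = sigma_sets (space P) (G \<union> null_sets P)" using 1 S by auto
  moreover have "countable G" using E R by (simp add: G_def)
  ultimately show ?thesis using that G_P by blast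
qed

section \<open>From exchangeability to conditional independence\<close>

lemma ess_iid_of_ess_pairwise_exchangeable:
  assumes exch: "ess_pairwise_exchangeable L P f"
  shows "ess_iid_given L P C f"
proof -
  obtain E :: "'x set set" where E: "countable E" and bor: "borel = sigma UNIV E"
    using borel_countable_Int_stable_generator by metis
  obtain G where G: "countable G" "G \<subseteq> sets P" "sets C = sigma_sets (space P) (G \<union> null_sets P)"
    using C_countable_generator .
  interpret C: finite_measure_subalgebra P C
    by unfold_locales (rule subalgebra_C)
  let ?m = "\<lambda>B \<omega>. measure (section_distr L f \<omega>) B"
  have m_C[measurable]: "?m B \<in> borel_measurable C" if "B \<in> sets borel" for B
    using measurable_compose[OF section_distr_measurable_C measurable_measure_prob_algebra] that .
  have cg: "countably_generated_subalgebra P C"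
    unfolding countably_generated_subalgebra_def
    using subalgebra_C G sets.sets_into_space[of _ P] by blast
  have sets_CP: "A \<in> sets P" if "A \<in> sets C" for A
    using that subalgebra_C by (auto simp: subalgebra_def)
  have reg: "AE i in L. regular_cond_distr P C (\<lambda>\<omega>. f (i, \<omega>)) (section_distr L f)"
    using AE_set_integral_section_distr_sigma_sets[OF exch G(1,2)] AE_sections_measurable(1)
  proof eventually_elim
    case (elim i)
    note fi[measurable] = elim(2)
    have "AE \<omega> in P. ?m B \<omega> = cond_probability P C ((\<lambda>\<omega>. f (i, \<omega>)) -` B \<inter> space P) \<omega>"
      if B[measurable]: "B \<in> sets borel" for B
    proof -
      let ?F = "(\<lambda>\<omega>. f (i, \<omega>)) -` B \<inter> space P"
      \<comment> \<open>A \<open>C\<close>-measurable function with the right integrals over all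
        sets of \<open>C\<close> is the conditional expectation.\<close>
      have "AE \<omega> in P. real_cond_exp P C (indicator ?F) \<omega> = ?m B \<omega>"
      proof (rule C.real_cond_exp_charact)
        fix A assume A: "A \<in> sets C"
        then have [measurable]: "A \<in> sets P" by (rule sets_CP)
        have "(LINT \<omega>:A|P. indicat_real ?F \<omega>) = (LINT \<omega>:A|P. indicator B (f (i, \<omega>)))"
          unfolding set_lebesgue_integral_def
          by (intro Bochner_Integration.integral_cong) (auto simp: indicator_def)
        then show "(LINT \<omega>:A|P. indicator ?F \<omega>) = (LINT \<omega>:A|P. ?m B \<omega>)"
          using bspec[OF bspec[OF elim(1) A[unfolded G(3)]] B] by simp
      qed (auto intro!: P.integrable_const_bound[of _ 1] measurable_sets[OF fi] m_C)
      then show ?thesis unfolding cond_probability_def by eventually_elim simp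
    qed
    then show ?case
      unfolding regular_cond_distr_def by simp
  qed
  have "AE i1 in L. AE i2 in L. cond_indep_given P C (\<lambda>\<omega>. f (i1, \<omega>)) (\<lambda>\<omega>. f (i2, \<omega>))"
    using reg
  proof eventually_elim
    case (elim i)
    note reg_i = elim
    then have fi[measurable]: "(\<lambda>\<omega>. f (i, \<omega>)) \<in> borel_measurable P"
      by (simp add: regular_cond_distr_def)
    \<comment> \<open>With the null sets, \<open>G'\<close> generates \<open>C\<close> enlarged by
      the section at \<open>i\<close>. It is countable for fixed \<open>i\<close>, so the integral
      identity holds on it for almost all \<open>j\<close>; the exceptional set may depend on
      \<open>i\<close>, as the nested quantifiers allow.\<close>
    define G' where "G' = G \<union> (\<lambda>B. (\<lambda>\<omega>. f (i, \<omega>)) -` B \<inter> space P) ` E"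
    have "countable G'" using G E by (auto simp: G'_def)
    moreover have G'P: "G' \<subseteq> sets P"
      using G(2) by (auto simp: G'_def bor intro!: measurable_sets[OF fi])
    ultimately have "AE j in L. \<forall>A\<in>sigma_sets (space P) (G' \<union> null_sets P). \<forall>B\<in>sets borel.
        (LINT \<omega>:A|P. indicator B (f (j, \<omega>))) = (LINT \<omega>:A|P. ?m B \<omega>)"
      by (rule AE_set_integral_section_distr_sigma_sets[OF exch])
    with reg show ?case
    proof eventually_elim
      case (elim j)
      note reg_j = elim(1) and eq = elim(2)
      have fj[measurable]: "(\<lambda>\<omega>. f (j, \<omega>)) \<in> borel_measurable P"
        using reg_j by (simp add: regular_cond_distr_def)
      show ?case
        unfolding cond_indep_given_def
      proof (intro conjI fi fj ballI)
        fix B1 B2 :: "'x set" assume B[measurable]: "B1 \<in> sets borel" "B2 \<in> sets borel"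
        let ?F1 = "(\<lambda>\<omega>. f (i, \<omega>)) -` B1 \<inter> space P" and ?F2 = "(\<lambda>\<omega>. f (j, \<omega>)) -` B2 \<inter> space P"
        have F[measurable]: "?F1 \<in> sets P" "?F2 \<in> sets P"
          by (rule measurable_sets[OF fi B(1)], rule measurable_sets[OF fj B(2)])
        have m1: "AE \<omega> in P. ?m B1 \<omega> = cond_probability P C ?F1 \<omega>"
          by (rule bspec[OF _ B(1)]) (use reg_i in \<open>simp add: regular_cond_distr_def\<close>)
        have m2: "AE \<omega> in P. ?m B2 \<omega> = cond_probability P C ?F2 \<omega>"
          by (rule bspec[OF _ B(2)]) (use reg_j in \<open>simp add: regular_cond_distr_def\<close>)
        have "AE \<omega> in P. real_cond_exp P C (indicator (?F1 \<inter> ?F2)) \<omega> = ?m B1 \<omega> * ?m B2 \<omega>"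
        proof (rule C.real_cond_exp_charact)
          fix A assume A[measurable]: "A \<in> sets C"
          then have AP[measurable]: "A \<in> sets P" by (rule sets_CP)
          \<comment> \<open>The set \<open>A\<close> is covered because \<open>G'\<close> contains
            \<open>G\<close>, and \<open>?F1\<close> because \<open>G'\<close> contains the
            preimages of the generator \<open>E\<close>.\<close>
          have AF1: "A \<inter> ?F1 \<in> sigma_sets (space P) (G' \<union> null_sets P)"
          proof -
            define S where "S = sigma (space P) (G' \<union> null_sets P)"
            have "G' \<union> null_sets P \<subseteq> Pow (space P)"
              using G'P sets.sets_into_space[of _ P] by auto
            then have S: "space S = space P" "sets S = sigma_sets (space P) (G' \<union> null_sets P)"
              by (simp_all add: S_def)
            have "(\<lambda>\<omega>. f (i, \<omega>)) \<in> borel_measurable S"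
              unfolding bor
            proof (rule measurable_measure_of)
              show "(\<lambda>\<omega>. f (i, \<omega>)) -` B \<inter> space S \<in> sets S" if "B \<in> E" for B
                unfolding S using that by (intro sigma_sets.Basic) (auto simp: G'_def)
            qed auto
            from measurable_sets[OF this B(1)] have "?F1 \<in> sets S" by (simp add: S)
            moreover have "A \<in> sets S"
              using A sigma_sets_mono'[of "G \<union> null_sets P" "G' \<union> null_sets P"]
              by (auto simp: S G(3) G'_def)
            ultimately show ?thesis unfolding S(2)[symmetric] by (rule sets.Int[rotated])
          qed
          \<comment> \<open>Moving \<open>?F1\<close> from the integrand to the domain of
            integration makes the identity for \<open>j\<close> on the enlarged \<sigma>-algebra
            applicable.\<close>
          have "(LINT \<omega>:A|P. indicator (?F1 \<inter> ?F2) \<omega>) = (LINT \<omega>:A \<inter> ?F1|P. indicator B2 (f (j, \<omega>)))"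
            unfolding set_lebesgue_integral_def
            by (intro Bochner_Integration.integral_cong) (auto simp: indicator_def)
          also have "\<dots> = (LINT \<omega>:A \<inter> ?F1|P. ?m B2 \<omega>)"
            by (rule bspec[OF bspec[OF eq AF1] B(2)])
          also have "\<dots> = (\<integral>\<omega>. (indicator A \<omega> * ?m B2 \<omega>) * indicator ?F1 \<omega> \<partial>P)"
            unfolding set_lebesgue_integral_def
            by (intro Bochner_Integration.integral_cong) (auto simp: indicator_def)
          \<comment> \<open>The weight is \<open>C\<close>-measurable, so the indicator of
            \<open>?F1\<close> may be replaced by its conditional expectation.\<close>
          also have "\<dots> = (\<integral>\<omega>. (indicator A \<omega> * ?m B2 \<omega>) * real_cond_exp P C (indicator ?F1) \<omega> \<partial>P)"
          proof (rule C.real_cond_exp_intg(2)[symmetric])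
            show "integrable P (\<lambda>\<omega>. (indicator A \<omega> * ?m B2 \<omega>) * indicator ?F1 \<omega>)"
              by (rule P.integrable_const_bound[of _ 1]) (auto simp: abs_mult intro!: mult_le_one)
          qed measurable
          also have "\<dots> = (LINT \<omega>:A|P. ?m B1 \<omega> * ?m B2 \<omega>)"
            unfolding set_lebesgue_integral_def
          proof (rule integral_cong_AE)
            show "AE \<omega> in P. (indicator A \<omega> * ?m B2 \<omega>) * real_cond_exp P C (indicator ?F1) \<omega>
                = indicator A \<omega> *\<^sub>R (?m B1 \<omega> * ?m B2 \<omega>)"
              using m1 unfolding cond_probability_def by eventually_elim simp
          qed measurable
          finally show "(LINT \<omega>:A|P. indicator (?F1 \<inter> ?F2) \<omega>) = (LINT \<omega>:A|P. ?m B1 \<omega> * ?m B2 \<omega>)" .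
        next
          show "integrable P (\<lambda>\<omega>. ?m B1 \<omega> * ?m B2 \<omega>)"
            by (rule P.integrable_const_bound[of _ 1]) (auto simp: abs_mult intro!: mult_le_one)
          show "integrable P (indicat_real (?F1 \<inter> ?F2))"
            by (rule P.integrable_const_bound[of _ 1]) simp_all
          show "(\<lambda>\<omega>. ?m B1 \<omega> * ?m B2 \<omega>) \<in> borel_measurable C"
            by (intro borel_measurable_times m_C B)
        qed
        then show "AE \<omega> in P. cond_probability P C (?F1 \<inter> ?F2) \<omega>
            = cond_probability P C ?F1 \<omega> * cond_probability P C ?F2 \<omega>"
          using m1 m2 unfolding cond_probability_def[of _ _ "?F1 \<inter> ?F2"] by eventually_elim simp
      qed
    qed
  qed
  then show ?thesis
    unfolding ess_iid_given_def using cg reg section_distr_measurable_C by blast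
qed

end

section \<open>From conditional independence to exchangeability\<close>

text \<open>Integrating the product formula for conditional probabilities gives the expectation of
  \<open>measure (\<mu> \<omega>) B1 * measure (\<mu> \<omega>) B2\<close> for almost all pairs of
  indices. This is the value of the mixture \<open>\<pi>\<close> at a rectangle, and it is symmetric
  because multiplication commutes.\<close>

lemma ess_pairwise_exchangeable_of_ess_iid:
  fixes f :: "'i \<times> 'w \<Rightarrow> 'x::topological_space"
  assumes "prob_space P" and iid: "ess_iid_given L P C f"
  shows "ess_pairwise_exchangeable L P f"
proof -
  interpret P: prob_space P by fact
  have sub: "subalgebra P C"
    using iid unfolding ess_iid_given_def countably_generated_subalgebra_def by blast
  interpret C: finite_measure_subalgebra P C
    by unfold_locales (rule sub)
  obtain \<mu> where "\<mu> \<in> C \<rightarrow>\<^sub>M prob_algebra borel"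
    and reg: "AE i in L. regular_cond_distr P C (\<lambda>\<omega>. f (i, \<omega>)) \<mu>"
    and ind: "AE i1 in L. AE i2 in L. cond_indep_given P C (\<lambda>\<omega>. f (i1, \<omega>)) (\<lambda>\<omega>. f (i2, \<omega>))"
    using iid unfolding ess_iid_given_def by blast
  \<comment> \<open>The mixture is formed over \<open>P\<close>, so measurability is passed from
    \<open>C\<close> to \<open>P\<close>.\<close>
  then have \<mu>[measurable]: "\<mu> \<in> P \<rightarrow>\<^sub>M prob_algebra borel"
    using measurable_from_subalg[OF sub] by blast
  have \<mu>_prob: "prob_space (\<mu> \<omega>)" "sets (\<mu> \<omega>) = sets borel" if "\<omega> \<in> space P" for \<omega>
    using measurable_space[OF \<mu> that] by (simp_all add: space_prob_algebra)
  have P_alg: "P \<in> space (prob_algebra P)"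
    by (simp add: space_prob_algebra P.prob_space_axioms)
  have prod[measurable]: "(\<lambda>\<omega>. \<mu> \<omega> \<Otimes>\<^sub>M \<mu> \<omega>) \<in> P \<rightarrow>\<^sub>M prob_algebra (borel \<Otimes>\<^sub>M borel)"
    by (rule measurable_pair_prob[OF \<mu> \<mu>])
  have m: "(\<lambda>\<omega>. measure (\<mu> \<omega>) B) \<in> borel_measurable P" if "B \<in> sets borel" for B
    using measurable_compose[OF \<mu> measurable_measure_prob_algebra] that .
  define \<pi> where "\<pi> = P \<bind> (\<lambda>\<omega>. \<mu> \<omega> \<Otimes>\<^sub>M \<mu> \<omega>)"
  have \<pi>_prob: "prob_space \<pi>" and \<pi>_sets: "sets \<pi> = sets (borel \<Otimes>\<^sub>M borel)"
    unfolding \<pi>_def by (rule prob_space_bind'[OF P_alg prod], rule sets_bind'[OF P_alg prod])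
  have \<pi>: "measure \<pi> (B1 \<times> B2) = (\<integral>\<omega>. measure (\<mu> \<omega>) B1 * measure (\<mu> \<omega>) B2 \<partial>P)"
    if [measurable]: "B1 \<in> sets borel" "B2 \<in> sets borel" for B1 B2
  proof -
    have "emeasure \<pi> (B1 \<times> B2) = (\<integral>\<^sup>+\<omega>. emeasure (\<mu> \<omega> \<Otimes>\<^sub>M \<mu> \<omega>) (B1 \<times> B2) \<partial>P)"
      unfolding \<pi>_def by (rule emeasure_bind_prob_algebra[OF P_alg prod]) (simp add: that)
    also have "\<dots> = (\<integral>\<^sup>+\<omega>. ennreal (measure (\<mu> \<omega>) B1 * measure (\<mu> \<omega>) B2) \<partial>P)"
    proof (rule nn_integral_cong)
      fix \<omega> assume \<omega>: "\<omega> \<in> space P"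
      interpret M: prob_space "\<mu> \<omega>" by (rule \<mu>_prob[OF \<omega>])
      show "emeasure (\<mu> \<omega> \<Otimes>\<^sub>M \<mu> \<omega>) (B1 \<times> B2) = ennreal (measure (\<mu> \<omega>) B1 * measure (\<mu> \<omega>) B2)"
        using \<mu>_prob[OF \<omega>] that
        by (subst M.emeasure_pair_measure_Times) (auto simp: M.emeasure_eq_measure ennreal_mult')
    qed
    also have "\<dots> = ennreal (\<integral>\<omega>. measure (\<mu> \<omega>) B1 * measure (\<mu> \<omega>) B2 \<partial>P)"
    proof (intro nn_integral_eq_integral P.integrable_const_bound[of _ 1] AE_I2)
      fix \<omega> assume "\<omega> \<in> space P"
      then show "norm (measure (\<mu> \<omega>) B1 * measure (\<mu> \<omega>) B2) \<le> 1"
        using prob_space.prob_le_1[OF \<mu>_prob(1)] by (auto simp: abs_mult intro!: mult_le_one)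
    qed (auto intro!: borel_measurable_times m that)
    finally show ?thesis
      by (simp add: measure_def[of \<pi>] integral_nonneg_AE)
  qed
  have "AE i1 in L. AE i2 in L. \<forall>B1\<in>sets borel. \<forall>B2\<in>sets borel.
    measure P {\<omega>\<in>space P. f (i1, \<omega>) \<in> B1 \<and> f (i2, \<omega>) \<in> B2} = measure \<pi> (B1 \<times> B2)"
    using reg ind
  proof eventually_elim
    case (elim i)
    note reg_i = elim(1)
    from reg elim(2) show ?case
    proof (eventually_elim, intro ballI)
      fix j and B1 B2 :: "'x set"
      assume reg_j: "regular_cond_distr P C (\<lambda>\<omega>. f (j, \<omega>)) \<mu>"
        and ind: "cond_indep_given P C (\<lambda>\<omega>. f (i, \<omega>)) (\<lambda>\<omega>. f (j, \<omega>))"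
        and B: "B1 \<in> sets borel" "B2 \<in> sets borel"
      let ?F1 = "(\<lambda>\<omega>. f (i, \<omega>)) -` B1 \<inter> space P" and ?F2 = "(\<lambda>\<omega>. f (j, \<omega>)) -` B2 \<inter> space P"
      have F[measurable]: "?F1 \<in> sets P" "?F2 \<in> sets P"
        using reg_i reg_j B unfolding regular_cond_distr_def by (blast intro: measurable_sets)+
      have int: "integrable P (indicator (?F1 \<inter> ?F2) :: 'w \<Rightarrow> real)"
        by (rule P.integrable_const_bound[of _ 1]) auto
      have "AE \<omega> in P. measure (\<mu> \<omega>) B1 = cond_probability P C ?F1 \<omega>"
        "AE \<omega> in P. measure (\<mu> \<omega>) B2 = cond_probability P C ?F2 \<omega>"
        "AE \<omega> in P. cond_probability P C (?F1 \<inter> ?F2) \<omega> = cond_probability P C ?F1 \<omega> * cond_probability P C ?F2 \<omega>"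
        using reg_i reg_j ind B unfolding regular_cond_distr_def cond_indep_given_def by blast+
      then have ae: "AE \<omega> in P. real_cond_exp P C (indicator (?F1 \<inter> ?F2)) \<omega> = measure (\<mu> \<omega>) B1 * measure (\<mu> \<omega>) B2"
        unfolding cond_probability_def[symmetric] by eventually_elim simp
      have "{\<omega>\<in>space P. f (i, \<omega>) \<in> B1 \<and> f (j, \<omega>) \<in> B2} = ?F1 \<inter> ?F2" by auto
      then have "measure P {\<omega>\<in>space P. f (i, \<omega>) \<in> B1 \<and> f (j, \<omega>) \<in> B2} = (\<integral>\<omega>. indicator (?F1 \<inter> ?F2) \<omega> \<partial>P)"
        using F by simp
      \<comment> \<open>Conditional expectation preserves the integral, after which the almost sure
        product formula \<open>ae\<close> can be inserted.\<close>
      also have "\<dots> = (\<integral>\<omega>. real_cond_exp P C (indicator (?F1 \<inter> ?F2)) \<omega> \<partial>P)"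
        using C.real_cond_exp_int(2)[OF int] by simp
      also have "\<dots> = (\<integral>\<omega>. measure (\<mu> \<omega>) B1 * measure (\<mu> \<omega>) B2 \<partial>P)"
        using B by (intro integral_cong_AE ae borel_measurable_times m) simp_all
      finally show "measure P {\<omega>\<in>space P. f (i, \<omega>) \<in> B1 \<and> f (j, \<omega>) \<in> B2} = measure \<pi> (B1 \<times> B2)"
        using \<pi>[OF B] by simp
    qed
  qed
  moreover have "measure \<pi> (B1 \<times> B2) = measure \<pi> (B2 \<times> B1)"
    if "B1 \<in> sets borel" "B2 \<in> sets borel" for B1 B2
    using that by (simp add: \<pi> mult.commute)
  ultimately show ?thesis
    unfolding ess_pairwise_exchangeable_def using \<pi>_prob \<pi>_sets by (intro exI[of _ \<pi>]) simp
qed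

theorem proposition3:
  fixes L :: "'i measure" and P :: "'w measure" and Q :: "('i \<times> 'w) measure"
    and f :: "'i \<times> 'w \<Rightarrow> 'x::polish_space"
  assumes "prob_space L" and "complete_measure L" and "atomless L"
    and "prob_space P" and "complete_measure P"
    and "fubini_extension L P Q"
    and "f \<in> borel_measurable Q"
  shows "ess_pairwise_exchangeable L P f \<longleftrightarrow>
    ess_iid_given L P (generated_algebra P (prob_algebra borel) (section_distr L f)) f"
proof
  interpret fubini_process L P Q f
    using assms by (intro fubini_process.intro fubini_process_axioms.intro)
  show "ess_pairwise_exchangeable L P f \<Longrightarrow>
    ess_iid_given L P (generated_algebra P (prob_algebra borel) (section_distr L f)) f"
    by (rule ess_iid_of_ess_pairwise_exchangeable)
qed (rule ess_pairwise_exchangeable_of_ess_iid[OF \<open>prob_space P\<close>])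

end
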